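(* For every name $u$, $\mathrm{PointSet\_stable}(\mathrm{GClosurePoint}(u))$.
   Context: Logic is classical. Names form a type $N$; a name may designate zero, one or several objects. The relation $\eta : N\to N\to \mathrm{Prop}$ (singular inclusion) is governed by Leśniewski's Ontology: $\eta\,A\,b$ holds iff [there is $C$ with $\eta\,C\,A$] and [for all $C,D$, $\eta\,C\,A$ and $\eta\,D\,A$ imply $\eta\,C\,D$] and [for all $C$, $\eta\,C\,A$ implies $\eta\,C\,b$]; i.e. $A$ designates exactly one object, which is among those designated by $b$. $A$ is an Individual iff $\eta\,A\,A$. Notation: $P\equiv Q$ iff $\eta\,P\,Q$ and $\eta\,Q\,P$; $a\approx b$ iff $\forall P,\ \eta\,P\,a\leftrightarrow\eta\,P\,b$. Names with the same extension are interchangeable. Name-forming operators are introduced by stating when $\eta\,P\,(\cdot)$ holds. Mereology: $\eta\,P\,(\mathrm{pt}(Q))$ ("$P$ is a part of $Q$") relates individuals and is reflexive on individuals, transitive, and antisymmetric up to $\equiv$; a proper part of $Q$ is a part $P$ with not $P\equiv Q$; $\eta\,P\,(\mathrm{ext}(Q))$ ("$P$ is external to $Q$") means $P,Q$ are individuals with no common part. Geometry: $\mathrm{balls}$ is a primitive name whose members are individuals (balls); at least one ball exists. $\eta\,P\,(\mathrm{Concent}(Q))$ means that the balls $P,Q$ are concentric in Tarski's sense: $P\equiv Q$; or $P$ is a proper part of $Q$ and any two balls $X,Y$ externally diametrical to $P$ and internally tangent to $Q$ are internally diametrical to $Q$; or the same with $P,Q$ exchanged. Here (all variables balls): $A$ is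 externally tangent to $B$ if $A$ is external to $B$ and of any two balls $X,Y$ having $A$ as part and external to $B$ one is part of the other; $A$ is internally tangent to $B$ if $A$ is a proper part of $B$ and of any two balls $X,Y$ having $A$ as part and being parts of $B$ one is part of the other; $A,B$ are externally diametrical to $C$ if both are externally tangent to $C$ and whenever $X,Y$ are external to $C$, $A$ is part of $X$ and $B$ is part of $Y$, then $X$ is external to $Y$; $A,B$ are internally diametrical to $C$ if both are internally tangent to $C$ and whenever $X,Y$ are external to $C$, $A$ is externally tangent to $X$ and $B$ to $Y$, then $X$ is external to $Y$. $\eta\,P\,(\mathrm{Point}(Q))$ iff $\eta\,P\,\mathrm{balls}$, $\eta\,Q\,\mathrm{balls}$ and $\eta\,P\,(\mathrm{Concent}(Q))$. Standing assumptions: concentricity is an equivalence relation on balls, and concentric balls $P,Q$ satisfy $\mathrm{Point}(P)\approx\mathrm{Point}(Q)$. Point-class notions: $\mathrm{same\_center}(P,Q)$ iff $\mathrm{Point}(P)\approx\mathrm{Point}(Q)$. $\mathrm{PointSet\_incl}(u,v)$ iff for all $B$ with $\eta\,B\,\mathrm{balls}$, $\eta\,B\,u$ implies $\eta\,B\,v$. $\mathrm{PointSet\_stable}(u)$ iff for all $B,C$, $\mathrm{same\_center}(B,C)$ and $\eta\,B\,u$ imply $\eta\,C\,u$. $\mathrm{PointSet\_meet}(u,v)$ iff there are $B,C$ with $\eta\,B\,\mathrm{balls}$, $\eta\,C\,\mathrm{balls}$, $\mathrm{same\_center}(B,C)$, $\eta\,B\,u$ and $\eta\,C\,v$. $\eta\,P\,\mathrm{GBasicPointSet}(Q)$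 iff $\eta\,Q\,\mathrm{balls}$, $\eta\,P\,\mathrm{balls}$ and there is $C$ with $\eta\,C\,\mathrm{balls}$, $\mathrm{same\_center}(P,C)$ and $\eta\,C\,(\mathrm{pt}(Q))$. $\mathrm{GPointOpen}(u)$ iff $\mathrm{PointSet\_stable}(u)$; and every $P$ with $\eta\,P\,u$ satisfies $\eta\,P\,\mathrm{balls}$; and for every $P$ with $\eta\,P\,u$ there is $Q$ with $\eta\,Q\,\mathrm{balls}$, $\eta\,P\,\mathrm{GBasicPointSet}(Q)$ and $\mathrm{PointSet\_incl}(\mathrm{GBasicPointSet}(Q),u)$. $\eta\,P\,\mathrm{GClosurePoint}(u)$ iff $\eta\,P\,\mathrm{balls}$ and for every $v$ with $\mathrm{GPointOpen}(v)$ and $\eta\,P\,v$, $\mathrm{PointSet\_meet}(v,u)$. *)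

theory Defs
  imports Main
begin

locale ontology =
  fixes eta :: "'n \<Rightarrow> 'n \<Rightarrow> bool"
  assumes eta_iff:
    "eta A b \<longleftrightarrow>
      (\<exists>C. eta C A) \<and> (\<forall>C D. eta C A \<and> eta D A \<longrightarrow> eta C D) \<and> (\<forall>C. eta C A \<longrightarrow> eta C b)"
begin

definition individual :: "'n \<Rightarrow> bool" where
  "individual A \<longleftrightarrow> eta A A"

definition sing_eq :: "'n \<Rightarrow> 'n \<Rightarrow> bool" where
  "sing_eq P Q \<longleftrightarrow> eta P Q \<and> eta Q P"

definition same_ext :: "'n \<Rightarrow> 'n \<Rightarrow> bool" where
  "same_ext a b \<longleftrightarrow> (\<forall>P. eta P a \<longleftrightarrow> eta P b)"

end

(* Interchangeability of coextensional names in every context is, in HOL, equality (Leibniz). *)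
locale extensional_ontology = ontology +
  assumes same_ext_imp_eq: "same_ext a b \<Longrightarrow> a = b"

(* Here and below, a name-forming operator is a function parameter f :: 'n => 'n that is
   constrained only by its introductory clause, which says when eta P (f Q) holds.  No general
   comprehension principle for names is assumed. *)
locale mereology = extensional_ontology eta
  for eta :: "'n \<Rightarrow> 'n \<Rightarrow> bool" +
  fixes pt :: "'n \<Rightarrow> 'n"
    and ext :: "'n \<Rightarrow> 'n"
  assumes pt_individual: "eta P (pt Q) \<Longrightarrow> individual P \<and> individual Q"
    and pt_refl: "individual P \<Longrightarrow> eta P (pt P)"
    and pt_trans: "eta P (pt Q) \<Longrightarrow> eta Q (pt R) \<Longrightarrow> eta P (pt R)"
    and pt_antisym: "eta P (pt Q) \<Longrightarrow> eta Q (pt P) \<Longrightarrow> sing_eq P Q"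
    and ext_iff:
      "eta P (ext Q) \<longleftrightarrow>
        individual P \<and> individual Q \<and> \<not> (\<exists>R. eta R (pt P) \<and> eta R (pt Q))"
begin

definition proper_part :: "'n \<Rightarrow> 'n \<Rightarrow> bool" where
  "proper_part P Q \<longleftrightarrow> eta P (pt Q) \<and> \<not> sing_eq P Q"

end

locale mereology_with_balls = mereology eta pt ext
  for eta :: "'n \<Rightarrow> 'n \<Rightarrow> bool" and pt ext :: "'n \<Rightarrow> 'n" +
  fixes balls :: 'n
  assumes balls_individual: "eta P balls \<Longrightarrow> individual P"
    and ball_exists: "\<exists>P. eta P balls"
begin

definition externally_tangent :: "'n \<Rightarrow> 'n \<Rightarrow> bool" where
  "externally_tangent A B \<longleftrightarrow>
    eta A balls \<and> eta B balls \<and> eta A (ext B) \<and>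
    (\<forall>X Y. eta X balls \<and> eta Y balls \<and>
       eta A (pt X) \<and> eta X (ext B) \<and> eta A (pt Y) \<and> eta Y (ext B) \<longrightarrow>
       eta X (pt Y) \<or> eta Y (pt X))"

definition internally_tangent :: "'n \<Rightarrow> 'n \<Rightarrow> bool" where
  "internally_tangent A B \<longleftrightarrow>
    eta A balls \<and> eta B balls \<and> proper_part A B \<and>
    (\<forall>X Y. eta X balls \<and> eta Y balls \<and>
       eta A (pt X) \<and> eta X (pt B) \<and> eta A (pt Y) \<and> eta Y (pt B) \<longrightarrow>
       eta X (pt Y) \<or> eta Y (pt X))"

definition externally_diametrical :: "'n \<Rightarrow> 'n \<Rightarrow> 'n \<Rightarrow> bool" where
  "externally_diametrical A B C \<longleftrightarrow>
    externally_tangent A C \<and> externally_tangent B C \<and>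
    (\<forall>X Y. eta X balls \<and> eta Y balls \<and>
       eta X (ext C) \<and> eta Y (ext C) \<and> eta A (pt X) \<and> eta B (pt Y) \<longrightarrow>
       eta X (ext Y))"

definition internally_diametrical :: "'n \<Rightarrow> 'n \<Rightarrow> 'n \<Rightarrow> bool" where
  "internally_diametrical A B C \<longleftrightarrow>
    internally_tangent A C \<and> internally_tangent B C \<and>
    (\<forall>X Y. eta X balls \<and> eta Y balls \<and>
       eta X (ext C) \<and> eta Y (ext C) \<and> externally_tangent A X \<and> externally_tangent B Y \<longrightarrow>
       eta X (ext Y))"

definition properly_concentric :: "'n \<Rightarrow> 'n \<Rightarrow> bool" where
  "properly_concentric P Q \<longleftrightarrow>
    proper_part P Q \<and>
    (\<forall>X Y. eta X balls \<and> eta Y balls \<and> externally_diametrical X Y P \<and>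
       internally_tangent X Q \<and> internally_tangent Y Q \<longrightarrow>
       internally_diametrical X Y Q)"

end

locale ball_geometry = mereology_with_balls eta pt ext balls
  for eta :: "'n \<Rightarrow> 'n \<Rightarrow> bool" and pt ext :: "'n \<Rightarrow> 'n" and balls :: 'n +
  fixes Concent :: "'n \<Rightarrow> 'n"
    and Point :: "'n \<Rightarrow> 'n"
  assumes Concent_iff:
      "eta P (Concent Q) \<longleftrightarrow>
        eta P balls \<and> eta Q balls \<and>
        (sing_eq P Q \<or> properly_concentric P Q \<or> properly_concentric Q P)"
    and Point_iff:
      "eta P (Point Q) \<longleftrightarrow> eta P balls \<and> eta Q balls \<and> eta P (Concent Q)"
    and Concent_equiv:
      "equiv {P. eta P balls} {(P, Q). eta P balls \<and> eta Q balls \<and> eta P (Concent Q)}"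
    and Concent_Point:
      "eta P balls \<Longrightarrow> eta Q balls \<Longrightarrow> eta P (Concent Q) \<Longrightarrow> same_ext (Point P) (Point Q)"
begin

definition same_center :: "'n \<Rightarrow> 'n \<Rightarrow> bool" where
  "same_center P Q \<longleftrightarrow> same_ext (Point P) (Point Q)"

definition PointSet_incl :: "'n \<Rightarrow> 'n \<Rightarrow> bool" where
  "PointSet_incl u v \<longleftrightarrow> (\<forall>B. eta B balls \<longrightarrow> eta B u \<longrightarrow> eta B v)"

definition PointSet_stable :: "'n \<Rightarrow> bool" where
  "PointSet_stable u \<longleftrightarrow> (\<forall>B C. same_center B C \<and> eta B u \<longrightarrow> eta C u)"

definition PointSet_meet :: "'n \<Rightarrow> 'n \<Rightarrow> bool" where
  "PointSet_meet u v \<longleftrightarrow>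
    (\<exists>B C. eta B balls \<and> eta C balls \<and> same_center B C \<and> eta B u \<and> eta C v)"

end

locale point_geometry_basic = ball_geometry eta pt ext balls Concent Point
  for eta :: "'n \<Rightarrow> 'n \<Rightarrow> bool" and pt ext :: "'n \<Rightarrow> 'n" and balls :: 'n
    and Concent Point :: "'n \<Rightarrow> 'n" +
  fixes GBasicPointSet :: "'n \<Rightarrow> 'n"
  assumes GBasicPointSet_iff:
    "eta P (GBasicPointSet Q) \<longleftrightarrow>
      eta Q balls \<and> eta P balls \<and> (\<exists>C. eta C balls \<and> same_center P C \<and> eta C (pt Q))"
begin

definition GPointOpen :: "'n \<Rightarrow> bool" where
  "GPointOpen u \<longleftrightarrow>
    PointSet_stable u \<and>
    (\<forall>P. eta P u \<longrightarrow> eta P balls) \<and>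
    (\<forall>P. eta P u \<longrightarrow>
       (\<exists>Q. eta Q balls \<and> eta P (GBasicPointSet Q) \<and> PointSet_incl (GBasicPointSet Q) u))"

end

locale point_geometry =
  point_geometry_basic eta pt ext balls Concent Point GBasicPointSet
  for eta :: "'n \<Rightarrow> 'n \<Rightarrow> bool" and pt ext :: "'n \<Rightarrow> 'n" and balls :: 'n
    and Concent Point GBasicPointSet :: "'n \<Rightarrow> 'n" +
  fixes GClosurePoint :: "'n \<Rightarrow> 'n"
  assumes GClosurePoint_iff:
    "eta P (GClosurePoint u) \<longleftrightarrow>
      eta P balls \<and> (\<forall>v. GPointOpen v \<and> eta P v \<longrightarrow> PointSet_meet v u)"

end

theory Submission
  imports Defs
begin

text \<open>
  The neighbourhoods that witness closure membership are open, and open names are by definition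
  saturated under \<open>same_center\<close>. Two concentric objects therefore lie in exactly the same open
  names, so the neighbourhood condition cannot tell them apart. The remaining clause, being a ball,
  also transfers, although \<open>same_center\<close> by itself does not require balls: a ball is concentric
  with itself, so its point is nonempty, whereas \<open>Point C\<close> is empty when \<open>C\<close> is not a ball
  (lemma \<open>same_center_ball\<close>).
\<close>

context ball_geometry
begin

lemma same_center_sym: "same_center B C \<Longrightarrow> same_center C B"
  unfolding same_center_def same_ext_def by blast

lemma ball_in_own_Point:
  assumes "eta B balls"
  shows "eta B (Point B)"
  using assms balls_individual
  unfolding Point_iff Concent_iff sing_eq_def individual_def by blast

text \<open>
  The ball \<open>B\<close> belongs to its own point, hence to \<open>Point C\<close>, and only balls have inhabited points.
\<close>

lemma same_center_ball:
  assumes "same_center B C" and "eta B balls"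
  shows "eta C balls"
proof -
  have "eta B (Point C)"
    using assms ball_in_own_Point unfolding same_center_def same_ext_def by blast
  then show ?thesis
    unfolding Point_iff by blast
qed

end

lemma (in point_geometry) PointSet_stable_GClosurePoint:
  "PointSet_stable (GClosurePoint u)"
  unfolding PointSet_stable_def
proof (intro allI impI, elim conjE)
  fix B C
  assume BC: "same_center B C" and B: "eta B (GClosurePoint u)"
  have "eta C balls"
    using BC B same_center_ball unfolding GClosurePoint_iff by blast
  moreover have "PointSet_meet v u" if v: "GPointOpen v" and "eta C v" for v
  proof -
    have "eta B v"
      using v \<open>eta C v\<close> same_center_sym[OF BC]
      unfolding GPointOpen_def PointSet_stable_def by blast
    then show ?thesis
      using B v unfolding GClosurePoint_iff by blast
  qed
  ultimately show "eta C (GClosurePoint u)"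
    unfolding GClosurePoint_iff by blast
qed

theorem lemma24:
  fixes eta :: "'n \<Rightarrow> 'n \<Rightarrow> bool"
    and pt ext :: "'n \<Rightarrow> 'n"
    and balls :: 'n
    and Concent Point GBasicPointSet GClosurePoint :: "'n \<Rightarrow> 'n"
  assumes "point_geometry eta pt ext balls Concent Point GBasicPointSet GClosurePoint"
  shows "\<forall>u. ball_geometry.PointSet_stable eta Point (GClosurePoint u)"
  using point_geometry.PointSet_stable_GClosurePoint[OF assms] by blast

end
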